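(* Let $X$ be a Banach space, let $\mathcal K\subset X$ be a compact subset with $\sup_{f\in\mathcal K}\|f\|_X=1$, and let $\lambda>1$ be a fixed constant. If there are $\alpha>0$ and $C>0$ such that $$e_n(\mathcal K)_X\ge C\,\frac{1}{[\log_2 n]^\alpha},\qquad n=2,3,\ldots,$$ then there is a constant $C''>0$, independent of $n$, such that $$d_{n-1}(\mathcal K,\lambda^n)_X\ge C''\,\frac1{[\log_2 n]^\alpha},\qquad n=2,3,\ldots.$$
   Context: All linear spaces are over the real numbers. For a compact set $\mathcal K\subset X$ the entropy numbers are $$e_n(\mathcal K)_X=\inf\Big\{\epsilon>0:\ \mathcal K\subset\bigcup_{j=1}^{2^n}B(g_j,\epsilon)\ \text{for some } g_1,\ldots,g_{2^n}\in X\Big\},\quad n\ge 0,$$ where $B(g,\epsilon)=\{f\in X:\|f-g\|_X\le\epsilon\}$. For real $N\ge1$ the nonlinear Kolmogorov $(n,N)$-width is $$d_0(\mathcal K,N)_X=\sup_{f\in\mathcal K}\|f\|_X,\qquad d_n(\mathcal K,N)_X=\inf_{\mathcal L_N}\ \sup_{f\in\mathcal K}\ \inf_{X_n\in\mathcal L_N}\operatorname{dist}(f,X_n)_X,\quad n\ge1,$$ where the outer infimum is over all sets $\mathcal L_N$ of at most $N$ linear subspaces $X_n\subset X$ of dimension $n$. The constant $C''$ may depend on $\mathcal K,\lambda,\alpha,C$. *)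

theory Defs
  imports "HOL-Analysis.Analysis"
begin

text \<open>
  Both quantities take values in \<^typ>\<open>ennreal\<close>, so that an infimum over an empty family
  is infinite and no supremum or infimum depends on an unspecified value.
\<close>

definition entropy_number :: "nat \<Rightarrow> 'a::real_normed_vector set \<Rightarrow> ennreal" where
  "entropy_number n K =
     (INF \<epsilon>\<in>{\<epsilon>::real. \<epsilon> > 0 \<and> (\<exists>g::nat \<Rightarrow> 'a. K \<subseteq> (\<Union>j\<in>{1..2 ^ n}. cball (g j) \<epsilon>))}. ennreal \<epsilon>)"

text \<open>
  The library sets \<^term>\<open>dim S = 0\<close> for infinite-dimensional \<^term>\<open>S\<close>; in the second
  branch below \<^term>\<open>n\<close> is positive, so \<^term>\<open>dim S = n\<close> forces \<^term>\<open>S\<close> to be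
  finite-dimensional of dimension exactly \<^term>\<open>n\<close>.
\<close>

definition subspace_families :: "nat \<Rightarrow> real \<Rightarrow> 'a::real_normed_vector set set set" where
  "subspace_families n N =
     {L. L \<noteq> {} \<and> finite L \<and> real (card L) \<le> N \<and> (\<forall>S\<in>L. subspace S \<and> dim S = n)}"

definition nonlinear_width :: "nat \<Rightarrow> 'a::real_normed_vector set \<Rightarrow> real \<Rightarrow> ennreal" where
  "nonlinear_width n K N =
     (if n = 0 then (SUP f\<in>K. ennreal (norm f))
      else (INF L\<in>subspace_families n N. SUP f\<in>K. INF S\<in>L. ennreal (infdist f S)))"

end

theory Submission imports Defs "HOL-Real_Asymp.Real_Asymp" begin

text \<open>
  If the width is smaller than \<open>\<delta>\<close>, then every point of \<open>K\<close> lies within \<open>\<delta>\<close> of a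
  bounded vector in one of at most \<open>lam ^ n\<close> subspaces of dimension \<open>n - 1\<close>, so coverings of
  the balls of these subspaces by balls of radius \<open>\<delta>\<close> give a covering of \<open>K\<close> by balls of
  radius \<open>2 * \<delta>\<close>; if it has at most \<open>2 ^ m\<close> members, the entropy number of index \<open>m\<close> is at
  most \<open>2 * \<delta>\<close>.

  The lower bound \<open>C / log 2 m powr \<alpha>\<close> on the entropy number sees \<open>m\<close> only through its
  logarithm, so replacing \<open>n\<close> by a power of \<open>n\<close> costs only a constant factor. A volume
  comparison would bound the covering number of a ball in dimension \<open>k\<close> by a power \<open>k\<close> of a
  multiple of \<open>1 / \<delta>\<close>, but a much cruder bound, exponential in \<open>k\<^sup>2\<close>, is good enough, and
  it follows by adding one basis vector at a time (\<open>finite_cover_cball_span\<close>).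

  Take \<open>\<delta> = 2 powr (- t) / log 2 n powr \<alpha>\<close>. The exponent \<open>m\<close> is then at most \<open>n\<^sup>2 * M\<close> with
  \<open>M\<close> affine in \<open>t\<close> (\<open>cover_exponent_bound\<close>), whence \<open>log 2 m \<le> (2 + log 2 M) * log 2 n\<close>,
  and the two bounds on the entropy number give
  \<open>C \<le> 2 * 2 powr (- t) * (2 + log 2 M) powr \<alpha>\<close>. The right-hand side tends to \<open>0\<close> as \<open>t\<close>
  grows, so a large \<open>t\<close>, the same for all \<open>n\<close>, is contradictory, and \<open>2 powr (- t)\<close> serves as
  the constant.
\<close>

section \<open>Covering balls of finite-dimensional subspaces\<close>

lemma obtain_near_point:
  assumes "A \<noteq> {}" and "infdist x A < \<epsilon>"
  obtains a where "a \<in> A" and "dist x a < \<epsilon>"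
proof -
  have "(INF a\<in>A. dist x a) < \<epsilon>"
    using assms by (simp add: infdist_def)
  then show thesis
    using assms(1) that by (subst (asm) cINF_less_iff) auto
qed

text \<open>
  One dimension is discretised here, which is the inductive step of the covering bound. Let \<open>d\<close>
  be the distance from \<open>b\<close> to \<open>span B\<close>. If \<open>d > 0\<close>, subtract from \<open>b\<close> a nearly closest
  point of \<open>span B\<close>, as in the lemma of Riesz: the coefficient along the resulting vector \<open>w\<close>,
  with \<open>norm w < 2 * d\<close>, of any \<open>s\<close> is at most \<open>norm s / d\<close> in absolute value. It can
  therefore be rounded to a short list of multiples of a fixed step, and the other component,
  which lies in \<open>span B\<close>, has norm at most \<open>3 * R\<close>. If \<open>d = 0\<close>, then \<open>span B\<close> is dense in
  \<open>span (insert b B)\<close> and the zero multiple suffices.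
\<close>
lemma cball_span_insert_near_line_times_ball:
  fixes b :: "'a::real_normed_vector"
  assumes "0 < \<delta>" and "\<delta> \<le> R"
  obtains J :: "int set" and v :: 'a where "finite J" and "real (card J) \<le> 11 * R / \<delta>"
    and "\<And>s. s \<in> span (insert b B) \<Longrightarrow> norm s \<le> R \<Longrightarrow>
      \<exists>j\<in>J. \<exists>t\<in>span B. norm t \<le> 3 * R \<and> norm (s - (of_int j *\<^sub>R v + t)) \<le> \<delta> / 2"
proof (cases "infdist b (span B) = 0")
  case True
  have "\<exists>j\<in>{0::int}. \<exists>t\<in>span B. norm t \<le> 3 * R \<and> norm (s - (of_int j *\<^sub>R 0 + t)) \<le> \<delta> / 2"
    if s: "s \<in> span (insert b B)" "norm s \<le> R" for s
  proof -
    obtain x where x: "s - x *\<^sub>R b \<in> span B"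
      using s(1) by (auto simp: span_insert)
    have "infdist b (span B) < \<delta> / (2 * (\<bar>x\<bar> + 1))"
      using True \<open>0 < \<delta>\<close> by simp
    then obtain u where u: "u \<in> span B" "dist b u < \<delta> / (2 * (\<bar>x\<bar> + 1))"
      using obtain_near_point[of "span B"] span_zero by blast
    define t where "t = (s - x *\<^sub>R b) + x *\<^sub>R u"
    have t: "t \<in> span B"
      unfolding t_def using x u(1) by (intro span_add span_scale)
    have "norm (s - t) = \<bar>x\<bar> * dist b u"
      by (simp add: t_def dist_norm algebra_simps flip: norm_scaleR)
    also have "\<dots> \<le> (\<bar>x\<bar> + 1) * (\<delta> / (2 * (\<bar>x\<bar> + 1)))"
      using u(2) by (intro mult_mono) auto
    also have "\<dots> = \<delta> / 2"
      by (simp add: field_simps)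
    finally have st: "norm (s - t) \<le> \<delta> / 2" .
    have "norm t \<le> norm s + norm (s - t)"
      using norm_triangle_ineq4[of s "s - t"] by simp
    then have "norm t \<le> 3 * R"
      using st s(2) assms by linarith
    with t st show ?thesis
      by auto
  qed
  moreover have "real (card {0::int}) \<le> 11 * R / \<delta>"
    using assms by (simp add: field_simps)
  ultimately show thesis
    using that[of "{0}" 0] by blast
next
  case False
  define d where "d = infdist b (span B)"
  have d: "0 < d"
    using False infdist_nonneg[of b "span B"] by (simp add: d_def)
  obtain u where u: "u \<in> span B" "dist b u < 2 * d"
    using obtain_near_point[of "span B" b "2 * d"] span_zero d by (auto simp: d_def)
  \<comment> \<open>rounding down to a multiple of this step moves a vector by at most \<open>h * (2 * d) = \<delta> / 2\<close>\<close>
  define h where "h = \<delta> / (4 * d)"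
  define N where "N = \<lceil>4 * R / \<delta>\<rceil>"
  have h: "0 < h"
    using d assms by (simp add: h_def)
  have ratio: "1 \<le> R / \<delta>"
    using assms by (simp add: field_simps)
  have N: "0 \<le> N" "4 * R / \<delta> \<le> of_int N" "of_int N \<le> 4 * R / \<delta> + 1"
    using ratio unfolding N_def by linarith+
  have "real (card {-N..N}) = 2 * of_int N + 1"
    using N(1) by simp
  also have "\<dots> \<le> 11 * R / \<delta>"
    using N(3) ratio by simp
  finally have card: "real (card {-N..N}) \<le> 11 * R / \<delta>" .
  have "\<exists>j\<in>{-N..N}. \<exists>t\<in>span B. norm t \<le> 3 * R \<and>
      norm (s - (of_int j *\<^sub>R (h *\<^sub>R (b - u)) + t)) \<le> \<delta> / 2"
    if s: "s \<in> span (insert b B)" "norm s \<le> R" for s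
  proof -
    obtain x where x: "s - x *\<^sub>R b \<in> span B"
      using s(1) by (auto simp: span_insert)
    define t where "t = (s - x *\<^sub>R b) + x *\<^sub>R u"
    have t: "t \<in> span B"
      unfolding t_def using x u(1) by (intro span_add span_scale)
    have s_eq: "s = x *\<^sub>R (b - u) + t"
      by (simp add: t_def algebra_simps)
    have xd: "\<bar>x\<bar> * d \<le> norm s"
    proof (cases "x = 0")
      case x0: False
      have "u - (1 / x) *\<^sub>R t \<in> span B"
        using u(1) t by (intro span_diff span_scale)
      then have "d \<le> norm (b - (u - (1 / x) *\<^sub>R t))"
        unfolding d_def dist_norm[symmetric] by (rule infdist_le)
      then have "\<bar>x\<bar> * d \<le> norm (x *\<^sub>R (b - (u - (1 / x) *\<^sub>R t)))"
        by (simp add: mult_left_mono)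
      also have "x *\<^sub>R (b - (u - (1 / x) *\<^sub>R t)) = s"
        using x0 by (simp add: s_eq algebra_simps)
      finally show ?thesis .
    qed simp
    define j where "j = \<lfloor>x / h\<rfloor>"
    have "\<bar>x / h\<bar> = 4 * (\<bar>x\<bar> * d) / \<delta>"
      using d assms by (simp add: h_def abs_mult)
    also have "\<dots> \<le> 4 * R / \<delta>"
      using xd s(2) assms by (intro divide_right_mono mult_left_mono) auto
    finally have "- of_int N \<le> x / h" "x / h \<le> of_int N"
      using N(2) by linarith+
    then have "- N \<le> j" "j \<le> N"
      unfolding j_def by linarith+
    then have j: "j \<in> {-N..N}"
      by simp
    have "norm t \<le> norm s + norm (x *\<^sub>R (b - u))"
      using norm_triangle_ineq4[of s "x *\<^sub>R (b - u)"] by (simp add: s_eq)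
    also have "norm (x *\<^sub>R (b - u)) \<le> \<bar>x\<bar> * (2 * d)"
      using u(2) by (simp add: dist_norm mult_left_mono)
    finally have tR: "norm t \<le> 3 * R"
      using xd s(2) by linarith
    have "\<bar>x / h - of_int j\<bar> \<le> 1"
      unfolding j_def by linarith
    have "s - (of_int j *\<^sub>R (h *\<^sub>R (b - u)) + t) = ((x / h - of_int j) * h) *\<^sub>R (b - u)"
      using h by (simp add: s_eq algebra_simps)
    then have "norm (s - (of_int j *\<^sub>R (h *\<^sub>R (b - u)) + t))
        = \<bar>x / h - of_int j\<bar> * (h * norm (b - u))"
      using h by (simp add: abs_mult)
    also have "\<dots> \<le> 1 * (h * (2 * d))"
      using u(2) h \<open>\<bar>x / h - of_int j\<bar> \<le> 1\<close> by (intro mult_mono) (auto simp: dist_norm)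
    also have "\<dots> = \<delta> / 2"
      using d by (simp add: h_def)
    finally show ?thesis
      using j t tR by blast
  qed
  then show thesis
    using that[of "{-N..N}" "h *\<^sub>R (b - u)"] card by blast
qed

text \<open>
  Each new basis vector triples the radius and halves the precision of the covering still needed
  in the remaining span, so the ratio \<open>R / \<delta>\<close> grows by a factor of 6 per dimension; the base of
  the bound absorbs this growth, so that all factors can be estimated by the largest of them.
\<close>
lemma finite_cover_cball_span:
  fixes B :: "'a::real_normed_vector set"
  assumes "finite B" and "0 < \<delta>" and "\<delta> \<le> R"
  shows "\<exists>G. finite G \<and> real (card G) \<le> (10 * 6 ^ card B * R / \<delta>) ^ card B \<and>
           span B \<inter> cball 0 R \<subseteq> (\<Union>g\<in>G. cball g \<delta>)"
  using assms
proof (induction B arbitrary: R \<delta> rule: finite_induct)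
  case empty
  then show ?case
    by (intro exI[of _ "{0}"]) auto
next
  case (insert b B)
  let ?k = "card B"
  let ?A = "10 * 6 ^ Suc ?k * R / \<delta>"
  have R: "0 < R" "1 \<le> R / \<delta>"
    using insert.prems by (auto simp: field_simps)
  obtain G where G: "finite G" "real (card G) \<le> (10 * 6 ^ ?k * (3 * R) / (\<delta> / 2)) ^ ?k"
    "span B \<inter> cball 0 (3 * R) \<subseteq> (\<Union>g\<in>G. cball g (\<delta> / 2))"
    using insert.IH[of "\<delta> / 2" "3 * R"] insert.prems by auto
  obtain J and v :: 'a where J: "finite J" "real (card J) \<le> 11 * R / \<delta>"
    and split: "\<And>s. s \<in> span (insert b B) \<Longrightarrow> norm s \<le> R \<Longrightarrow>
      \<exists>j\<in>J. \<exists>t\<in>span B. norm t \<le> 3 * R \<and> norm (s - (of_int j *\<^sub>R v + t)) \<le> \<delta> / 2"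
    using cball_span_insert_near_line_times_ball[OF insert.prems, of b B] by metis
  define G' where "G' = (\<lambda>(j, g). of_int j *\<^sub>R v + g) ` (J \<times> G)"
  have "finite G'"
    using J(1) G(1) by (simp add: G'_def)
  moreover have "real (card G') \<le> ?A ^ Suc ?k"
  proof -
    have "card G' \<le> card (J \<times> G)"
      unfolding G'_def by (rule card_image_le) (use J(1) G(1) in simp)
    then have "real (card G') \<le> real (card J) * real (card G)"
      by (simp add: card_cartesian_product flip: of_nat_mult)
    also have "\<dots> \<le> ?A * ?A ^ ?k"
    proof (intro mult_mono)
      have "(1::real) \<le> 6 ^ ?k"
        by simp
      then have "(11::real) \<le> 10 * 6 ^ Suc ?k"
        unfolding power_Suc by linarith
      then have "11 * (R / \<delta>) \<le> (10 * 6 ^ Suc ?k) * (R / \<delta>)"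
        using R by (intro mult_right_mono) linarith+
      then show "real (card J) \<le> ?A"
        using J(2) by simp
      show "real (card G) \<le> ?A ^ ?k"
        using G(2) by (simp add: mult_ac)
    qed (use insert.prems in auto)
    finally show ?thesis
      by simp
  qed
  moreover have "span (insert b B) \<inter> cball 0 R \<subseteq> (\<Union>g\<in>G'. cball g \<delta>)"
  proof
    fix s
    assume "s \<in> span (insert b B) \<inter> cball 0 R"
    then obtain j t where jt: "j \<in> J" "t \<in> span B" "norm t \<le> 3 * R"
      "norm (s - (of_int j *\<^sub>R v + t)) \<le> \<delta> / 2"
      using split[of s] by auto
    then obtain g where g: "g \<in> G" "dist g t \<le> \<delta> / 2"
      using G(3) by fastforce
    have "s - (of_int j *\<^sub>R v + g) = (s - (of_int j *\<^sub>R v + t)) + (t - g)"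
      by simp
    then have "norm (s - (of_int j *\<^sub>R v + g)) \<le> norm (s - (of_int j *\<^sub>R v + t)) + norm (t - g)"
      by (metis norm_triangle_ineq)
    then have "dist (of_int j *\<^sub>R v + g) s \<le> \<delta>"
      using jt(4) g(2) by (simp add: dist_norm norm_minus_commute)
    moreover have "of_int j *\<^sub>R v + g \<in> G'"
      using jt(1) g(1) by (force simp: G'_def)
    ultimately show "s \<in> (\<Union>g\<in>G'. cball g \<delta>)"
      by auto
  qed
  moreover have "card (insert b B) = Suc ?k"
    using insert.hyps by simp
  ultimately show ?case
    by metis
qed

section \<open>From the width to the entropy numbers\<close>

lemma entropy_number_le:
  fixes K :: "'a::real_normed_vector set"
  assumes "finite G" and "card G \<le> 2 ^ m" and "0 < \<epsilon>" and "K \<subseteq> (\<Union>g\<in>G. cball g \<epsilon>)"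
  shows "entropy_number m K \<le> ennreal \<epsilon>"
proof -
  obtain h where h: "bij_betw h {1..card G} G"
    using ex_bij_betw_nat_finite_1[OF assms(1)] by blast
  have "h ` {1..card G} \<subseteq> h ` {1..2 ^ m}"
    using assms(2) by (intro image_mono) auto
  then have "G \<subseteq> h ` {1..2 ^ m}"
    unfolding bij_betw_imp_surj_on[OF h] .
  then have "(\<Union>g\<in>G. cball g \<epsilon>) \<subseteq> (\<Union>g\<in>h ` {1..2 ^ m}. cball g \<epsilon>)"
    by (rule UN_mono) (rule order_refl)
  then have "K \<subseteq> (\<Union>j\<in>{1..2 ^ m}. cball (h j) \<epsilon>)"
    unfolding image_image by (rule order_trans[OF assms(4)])
  then have "\<epsilon> \<in> {\<epsilon>. \<epsilon> > 0 \<and> (\<exists>g::nat \<Rightarrow> 'a. K \<subseteq> (\<Union>j\<in>{1..2 ^ m}. cball (g j) \<epsilon>))}"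
    using assms(3) by blast
  then show ?thesis
    unfolding entropy_number_def by (rule INF_lower)
qed

text \<open>
  An approximant within \<open>\<delta> \<le> 1\<close> of a point of the unit ball has norm at most 2, so only the
  balls of radius 2 in the subspaces have to be covered; the approximation error and the covering
  radius add up to \<open>2 * \<delta>\<close>.
\<close>
lemma finite_cover_of_nonlinear_width_less:
  fixes K :: "'a::real_normed_vector set"
  assumes "0 < k" and "0 < \<delta>" and "\<delta> \<le> 1"
    and bounded: "\<And>f. f \<in> K \<Longrightarrow> norm f \<le> 1"
    and width: "nonlinear_width k K N < ennreal \<delta>"
  shows "\<exists>G. finite G \<and> real (card G) \<le> N * (20 * 6 ^ k / \<delta>) ^ k \<and>
           K \<subseteq> (\<Union>g\<in>G. cball g (2 * \<delta>))"
proof -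
  obtain L where L: "L \<in> subspace_families k N"
    and less: "(SUP f\<in>K. INF S\<in>L. ennreal (infdist f S)) < ennreal \<delta>"
    using width assms(1) by (auto simp: nonlinear_width_def INF_less_iff)
  have fin: "finite L" and card: "real (card L) \<le> N"
    using L by (auto simp: subspace_families_def)
  have "\<exists>G. finite G \<and> real (card G) \<le> (20 * 6 ^ k / \<delta>) ^ k \<and>
          S \<inter> cball 0 2 \<subseteq> (\<Union>g\<in>G. cball g \<delta>)" if "S \<in> L" for S
  proof -
    have S: "subspace S" "dim S = k"
      using that L by (auto simp: subspace_families_def)
    obtain B where B: "B \<subseteq> S" "independent B" "S \<subseteq> span B" "card B = dim S"
      using basis_exists by blast
    \<comment> \<open>an infinite basis would have cardinality 0, which differs from \<open>k\<close>\<close>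
    have "finite B"
      using B(4) S(2) assms(1) card.infinite by fastforce
    moreover have "span B = S"
      using B(1,3) S(1) span_minimal by blast
    ultimately show ?thesis
      using finite_cover_cball_span[of B \<delta> 2] assms(2,3) B(4) S(2) by (simp add: mult_ac)
  qed
  then obtain G where G: "\<And>S. S \<in> L \<Longrightarrow> finite (G S)"
    "\<And>S. S \<in> L \<Longrightarrow> real (card (G S)) \<le> (20 * 6 ^ k / \<delta>) ^ k"
    "\<And>S. S \<in> L \<Longrightarrow> S \<inter> cball 0 2 \<subseteq> (\<Union>g\<in>G S. cball g \<delta>)"
    by metis
  have "real (card (\<Union>S\<in>L. G S)) \<le> (\<Sum>S\<in>L. real (card (G S)))"
    using card_UN_le[OF fin, of G] by (simp flip: of_nat_sum)
  also have "\<dots> \<le> real (card L) * (20 * 6 ^ k / \<delta>) ^ k"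
    using G(2) by (rule sum_bounded_above)
  also have "\<dots> \<le> N * (20 * 6 ^ k / \<delta>) ^ k"
    using card assms(2) by (intro mult_right_mono) auto
  finally have "real (card (\<Union>S\<in>L. G S)) \<le> N * (20 * 6 ^ k / \<delta>) ^ k" .
  moreover have "K \<subseteq> (\<Union>g\<in>(\<Union>S\<in>L. G S). cball g (2 * \<delta>))"
  proof
    fix f
    assume f: "f \<in> K"
    have "(INF S\<in>L. ennreal (infdist f S)) < ennreal \<delta>"
      using f less by (meson SUP_upper le_less_trans)
    then obtain S where S: "S \<in> L" "infdist f S < \<delta>"
      by (auto simp: INF_less_iff ennreal_less_iff infdist_nonneg)
    have "S \<noteq> {}"
      using S(1) L by (auto simp: subspace_families_def dest: subspace_0)
    then obtain s where s: "s \<in> S" "dist f s < \<delta>"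
      using obtain_near_point[OF _ S(2)] by blast
    have "norm s \<le> norm f + dist f s"
      using norm_triangle_ineq4[of f "f - s"] by (simp add: dist_norm)
    then have "norm s \<le> 2"
      using bounded[OF f] s(2) assms(3) by linarith
    then obtain g where g: "g \<in> G S" "dist g s \<le> \<delta>"
      using G(3)[OF S(1)] s(1) by fastforce
    have "dist g f \<le> dist g s + dist f s"
      by (rule dist_triangle2)
    then have "dist g f \<le> 2 * \<delta>"
      using g(2) s(2) by linarith
    then show "f \<in> (\<Union>g\<in>(\<Union>S\<in>L. G S). cball g (2 * \<delta>))"
      using g(1) S(1) by auto
  qed
  ultimately show ?thesis
    using fin G(1) by blast
qed

text \<open>
  With \<open>a = 20 * 6 ^ n / \<delta>\<close> the number of balls is at most \<open>(lam * a) ^ n\<close>. Since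
  \<open>log 2 (log 2 n) \<le> n\<close>, the logarithm of \<open>lam * a\<close> is at most \<open>n * (M - 1)\<close>. Thus
  \<open>n\<^sup>2 * (M - 1)\<close> bounds the logarithm of the number of balls, and the remaining \<open>n\<^sup>2 \<ge> 4\<close>
  leaves room for rounding up to an integer that is at least 2.
\<close>
lemma cover_exponent_bound:
  fixes n :: nat and lam \<alpha> t :: real
  assumes n: "2 \<le> n" and "1 < lam" "0 < \<alpha>" "0 \<le> t"
    and \<delta>: "\<delta> = 2 powr (- t) / log 2 n powr \<alpha>"
    and M: "M = log 2 (120 * lam) + \<alpha> + 1 + t"
  obtains m :: nat where "2 \<le> m" and "log 2 m \<le> (2 + log 2 M) * log 2 n"
    and "lam ^ n * (20 * 6 ^ (n - 1) / \<delta>) ^ (n - 1) \<le> 2 ^ m"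
proof -
  define x where "x = log 2 (real n)"
  have x: "1 \<le> x" "x \<le> n"
    using n log_le_cancel_iff[of 2 2 "real n"] log2_of_power_le[of n n] less_exp[of n]
    by (auto simp: x_def)
  have "log 2 1 \<le> log 2 (120 * lam)"
    using assms(2) by (subst log_le_cancel_iff) auto
  then have M1: "1 \<le> M"
    using assms(3,4) by (simp add: M)
  have nM: "0 \<le> n\<^sup>2 * (M - 1)"
    using M1 by simp
  define m where "m = nat \<lceil>n\<^sup>2 * (M - 1)\<rceil> + 2"
  have m_ge: "n\<^sup>2 * (M - 1) \<le> real m" and m_le: "real m \<le> n\<^sup>2 * (M - 1) + 3"
    using nM unfolding m_def by linarith+
  have "2\<^sup>2 \<le> (real n)\<^sup>2"
    using n by (intro power_mono) auto
  then have "real m \<le> n\<^sup>2 * M"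
    using m_le by (simp add: algebra_simps)
  then have "log 2 m \<le> log 2 (n\<^sup>2 * M)"
    by (simp add: m_def)
  also have "\<dots> = 2 * x + log 2 M"
    using n M1 by (simp add: x_def log_mult log_nat_power)
  also have "\<dots> \<le> 2 * x + log 2 M * x"
    using x M1 mult_left_mono[of 1 x "log 2 M"] by simp
  finally have log_m: "log 2 m \<le> (2 + log 2 M) * log 2 n"
    by (simp add: x_def algebra_simps)
  have xa: "1 \<le> x powr \<alpha>"
    using x assms(3) by (simp add: ge_one_powr_ge_zero)
  have \<delta>_inverse: "1 / \<delta> = 2 powr t * x powr \<alpha>"
    by (simp add: \<delta> x_def powr_minus field_simps)
  have "1 * 1 \<le> 2 powr t * x powr \<alpha>"
    using assms(4) xa by (intro mult_mono) (auto simp: ge_one_powr_ge_zero)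
  then have \<delta>1: "0 < \<delta>" "1 \<le> 1 / \<delta>"
    using x by (auto simp: \<delta>_inverse) (auto simp: \<delta> x_def)
  define a where "a = 20 * 6 ^ n * (1 / \<delta>)"
  have "1 * 1 * 1 \<le> a"
    unfolding a_def using \<delta>1 by (intro mult_mono) auto
  then have a: "1 \<le> a"
    by simp
  have "20 * 6 ^ (n - 1) / \<delta> \<le> a"
    unfolding a_def using \<delta>1(1) by (simp add: divide_right_mono)
  then have "(20 * 6 ^ (n - 1) / \<delta>) ^ (n - 1) \<le> a ^ (n - 1)"
    using \<delta>1(1) by (intro power_mono) auto
  also have "\<dots> \<le> a ^ n"
    using a by (intro power_increasing) auto
  finally have "lam ^ n * (20 * 6 ^ (n - 1) / \<delta>) ^ (n - 1) \<le> (lam * a) ^ n"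
    using assms(2) by (simp add: power_mult_distrib)
  also have "\<dots> = 2 powr (n * log 2 (lam * a))"
    using assms(2) a by (simp add: powr_powr[symmetric] powr_realpow mult.commute[of "real n"])
  also have "\<dots> \<le> 2 powr (n\<^sup>2 * (M - 1))"
  proof (intro powr_mono)
    have "log 2 (lam * a) = log 2 (20 * lam) + n * log 2 6 + t + \<alpha> * log 2 x"
      using assms(2) x unfolding a_def \<delta>_inverse
      by (simp add: log_mult log_nat_power log_powr)
    also have "\<dots> \<le> n * log 2 (20 * lam) + n * log 2 6 + n * t + \<alpha> * n"
    proof -
      have "log 2 x \<le> n"
      proof -
        have "log 2 x \<le> log 2 n"
          using x by (intro log_mono) auto
        then show ?thesis
          using x(2) by (simp only: x_def)
      qed
      then have "\<alpha> * log 2 x \<le> \<alpha> * n"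
        using assms(3) by (intro mult_left_mono) auto
      moreover have "1 * t \<le> n * t"
        using n assms(4) by (intro mult_right_mono) auto
      moreover have "1 * log 2 (20 * lam) \<le> n * log 2 (20 * lam)"
        using n assms(2) by (intro mult_right_mono) auto
      ultimately show ?thesis
        by linarith
    qed
    also have "\<dots> = n * (M - 1)"
      using assms(2) log_mult[of 2 "20 * lam" 6] by (simp add: M algebra_simps)
    finally show "n * log 2 (lam * a) \<le> n\<^sup>2 * (M - 1)"
      by (simp add: power2_eq_square mult_left_mono mult.assoc)
  qed simp
  also have "\<dots> \<le> 2 powr m"
    using m_ge by (intro powr_mono) auto
  finally have "lam ^ n * (20 * 6 ^ (n - 1) / \<delta>) ^ (n - 1) \<le> 2 ^ m"
    by (simp add: powr_realpow)
  then show thesis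
    using that[of m] log_m by (simp add: m_def)
qed

section \<open>The lower bound on the width\<close>

theorem theorem4p9:
  fixes K :: "'a::banach set" and lam \<alpha> C :: real
  assumes "compact K"
    and "(SUP f\<in>K. ennreal (norm f)) = 1"
    and "lam > 1"
    and "\<alpha> > 0"
    and "C > 0"
    and "\<And>n::nat. n \<ge> 2 \<Longrightarrow> entropy_number n K \<ge> ennreal (C * (1 / (log 2 (real n)) powr \<alpha>))"
  shows "\<exists>C''::real. C'' > 0 \<and>
    (\<forall>n::nat\<ge>2. nonlinear_width (n - 1) K (lam ^ n) \<ge> ennreal (C'' * (1 / (log 2 (real n)) powr \<alpha>)))"
proof -
  define M where "M t = log 2 (120 * lam) + \<alpha> + 1 + t" for t
  have "((\<lambda>t. 2 * 2 powr (- t) * (2 + log 2 (M t)) powr \<alpha>) \<longlongrightarrow> 0) at_top"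
    unfolding M_def using \<open>\<alpha> > 0\<close> by real_asymp
  then have "\<forall>\<^sub>F t in at_top. 2 * 2 powr (- t) * (2 + log 2 (M t)) powr \<alpha> < C"
    using \<open>C > 0\<close> by (rule order_tendstoD)
  then have "\<forall>\<^sub>F t in at_top. 0 \<le> t \<and> 2 * 2 powr (- t) * (2 + log 2 (M t)) powr \<alpha> < C"
    using eventually_ge_at_top[of 0] by eventually_elim auto
  then obtain t where t: "0 \<le> t" "2 * 2 powr (- t) * (2 + log 2 (M t)) powr \<alpha> < C"
    using eventually_happens'[OF trivial_limit_at_top_linorder] by blast
  have bounded: "norm f \<le> 1" if "f \<in> K" for f
  proof -
    have "ennreal (norm f) \<le> 1"
      using that assms(2) by (metis SUP_upper)
    then show ?thesis
      by simp
  qed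
  have "ennreal (2 powr (- t) * (1 / log 2 n powr \<alpha>)) \<le> nonlinear_width (n - 1) K (lam ^ n)"
    if n: "2 \<le> n" for n :: nat
  proof (rule ccontr)
    define \<delta> where "\<delta> = 2 powr (- t) / log 2 n powr \<alpha>"
    assume "\<not> ?thesis"
    then have width: "nonlinear_width (n - 1) K (lam ^ n) < ennreal \<delta>"
      by (simp add: \<delta>_def)
    have log_n: "1 \<le> log 2 n"
      using n log_le_cancel_iff[of 2 2 "real n"] by simp
    then have "1 \<le> log 2 n powr \<alpha>"
      using \<open>\<alpha> > 0\<close> by (simp add: ge_one_powr_ge_zero)
    then have "2 powr (- t) / log 2 n powr \<alpha> \<le> 2 powr 0 / 1"
      using t(1) by (intro frac_le powr_mono) auto
    then have \<delta>: "0 < \<delta>" "\<delta> \<le> 1"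
      using log_n by (auto simp: \<delta>_def)
    obtain m where m: "2 \<le> m" "log 2 m \<le> (2 + log 2 (M t)) * log 2 n"
      "lam ^ n * (20 * 6 ^ (n - 1) / \<delta>) ^ (n - 1) \<le> 2 ^ m"
      using cover_exponent_bound[OF n assms(3,4) t(1) \<delta>_def M_def[of t]] by blast
    obtain G where G: "finite G" "K \<subseteq> (\<Union>g\<in>G. cball g (2 * \<delta>))"
      "real (card G) \<le> lam ^ n * (20 * 6 ^ (n - 1) / \<delta>) ^ (n - 1)"
      using finite_cover_of_nonlinear_width_less[OF _ \<delta> bounded width] n by auto
    have "real (card G) \<le> 2 ^ m"
      using G(3) m(3) by linarith
    then have "card G \<le> 2 ^ m"
      by (metis of_nat_le_iff of_nat_numeral of_nat_power)
    then have "entropy_number m K \<le> ennreal (2 * \<delta>)"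
      using G \<delta>(1) by (intro entropy_number_le) auto
    then have "ennreal (C * (1 / log 2 m powr \<alpha>)) \<le> ennreal (2 * \<delta>)"
      using assms(6)[OF m(1)] by (rule order_trans[rotated])
    then have C_le: "C / log 2 m powr \<alpha> \<le> 2 * \<delta>"
      using \<delta>(1) by simp
    have log_m: "1 \<le> log 2 m"
      using m(1) log_le_cancel_iff[of 2 2 "real m"] by simp
    have "C \<le> 2 * \<delta> * log 2 m powr \<alpha>"
      using C_le log_m by (simp add: field_simps)
    also have "\<dots> \<le> 2 * \<delta> * ((2 + log 2 (M t)) * log 2 n) powr \<alpha>"
      using m(2) log_m \<delta>(1) \<open>\<alpha> > 0\<close> by (intro mult_left_mono powr_mono2) auto
    also have "\<dots> = 2 * 2 powr (- t) * (2 + log 2 (M t)) powr \<alpha>"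
    proof -
      have "0 < (2 + log 2 (M t)) * log 2 n"
        using m(2) log_m by linarith
      then have "0 < 2 + log 2 (M t)"
        using log_n by (simp add: zero_less_mult_iff)
      then show ?thesis
        using log_n by (simp add: \<delta>_def powr_mult)
    qed
    finally show False
      using t(2) by linarith
  qed
  then show ?thesis
    by (intro exI[of _ "2 powr (- t)"]) auto
qed

end
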